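(* Let $\alpha>0$, $t>0$ and $\lambda,\sigma\in\mathbb{C}$ with $\lambda\neq\sigma$. (i) If $v_1,v_2<\alpha$ and $v=v_1+v_2$, then $$R_{\alpha,v_1}(\lambda,t)*R_{\alpha,v_2}(\sigma,t)=\frac{1}{\lambda-\sigma}\Big(\lambda R_{\alpha,v-\alpha}(\lambda,t)-\sigma R_{\alpha,v-\alpha}(\sigma,t)\Big).$$ (ii) If $w_1,w_2>-1$ and $w=w_1+w_2$, then $$P_{\alpha,w_1}(\lambda,t)*P_{\alpha,w_2}(\sigma,t)=\frac{1}{\lambda-\sigma}\Big(\lambda P_{\alpha,w+1}(\lambda,t)-\sigma P_{\alpha,w+1}(\sigma,t)\Big),$$ and $$t^{w_1}E_{\alpha,w_1+1}(\lambda t^\alpha)*t^{w_2}E_{\alpha,w_2+1}(\sigma t^\alpha)=\frac{1}{\lambda-\sigma}\Big(\lambda t^{w+1}E_{\alpha,w+2}(\lambda t^\alpha)-\sigma t^{w+1}E_{\alpha,w+2}(\sigma t^\alpha)\Big).$$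
   Context: For $\alpha,\beta>0$ and $z\in\mathbb{C}$, the Mittag-Leffler function is $E_{\alpha,\beta}(z)=\sum_{n=0}^\infty \frac{z^n}{\Gamma(\alpha n+\beta)}$. For $\lambda\in\mathbb{C}$, $\alpha>0$, $t>0$: $P_{\alpha,w}(\lambda,t)=t^wE_{\alpha,w+1}(\lambda t^\alpha)=\sum_{n=0}^\infty\frac{\lambda^n t^{\alpha n+w}}{\Gamma(\alpha n+w+1)}$ for $w>-1$, and $R_{\alpha,v}(\lambda,t)=t^{\alpha-v-1}E_{\alpha,\alpha-v}(\lambda t^\alpha)=\sum_{n=0}^\infty\frac{\lambda^n t^{\alpha(n+1)-v-1}}{\Gamma(\alpha(n+1)-v)}$ for $v<\alpha$. The symbol $*$ denotes the causal convolution in the variable $t$: $(f*g)(t)=\int_0^t f(t-\tau)g(\tau)\,d\tau$. Convention: $0^0=1$. *)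

theory Defs
  imports "HOL-Analysis.Analysis"
begin

definition mittag_leffler :: "real \<Rightarrow> real \<Rightarrow> complex \<Rightarrow> complex" where
  "mittag_leffler \<alpha> \<beta> z = (\<Sum>n. z ^ n / of_real (Gamma (\<alpha> * real n + \<beta>)))"

(* Meaningful for w > -1 and t > 0 (recall that 0 powr w = 0 for every w). *)
definition P_fun :: "real \<Rightarrow> real \<Rightarrow> complex \<Rightarrow> real \<Rightarrow> complex" where
  "P_fun \<alpha> w l t = of_real (t powr w) * mittag_leffler \<alpha> (w + 1) (l * of_real (t powr \<alpha>))"

(* Meaningful for v < \<alpha> and t > 0. *)
definition R_fun :: "real \<Rightarrow> real \<Rightarrow> complex \<Rightarrow> real \<Rightarrow> complex" where
  "R_fun \<alpha> v l t =
     of_real (t powr (\<alpha> - v - 1)) * mittag_leffler \<alpha> (\<alpha> - v) (l * of_real (t powr \<alpha>))"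

(* The library's interval integral ranges over the open interval, so f and g are evaluated
   at positive arguments only; they may be singular at 0. *)
definition causal_conv :: "(real \<Rightarrow> complex) \<Rightarrow> (real \<Rightarrow> complex) \<Rightarrow> real \<Rightarrow> complex" where
  "causal_conv f g t = (LBINT \<tau>=0..t. f (t - \<tau>) * g \<tau>)"

(* Existence of the convolution at t as a Lebesgue integral; causal_conv is 0 when this fails. *)
definition causal_conv_exists :: "(real \<Rightarrow> complex) \<Rightarrow> (real \<Rightarrow> complex) \<Rightarrow> real \<Rightarrow> bool" where
  "causal_conv_exists f g t \<longleftrightarrow>
     interval_lebesgue_integrable lborel 0 t (\<lambda>\<tau>. f (t - \<tau>) * g \<tau>)"

end

theory Submission
  imports Defs
begin

text \<open>
  The kernels \<open>g\<^sub>c(t) = t\<^sup>c\<^sup>-\<^sup>1 / \<Gamma>(c)\<close> satisfy \<open>g\<^sub>a * g\<^sub>b = g\<^sub>a\<^sub>+\<^sub>b\<close> by the Beta integral, and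
  \<open>t\<^sup>a\<^sup>-\<^sup>1 E(l t\<^sup>\<alpha>)\<close>, with parameters \<open>\<alpha>\<close> and \<open>a\<close>, is the series of the \<open>l\<^sup>n g\<^sub>c\<close> with \<open>c = \<alpha> n + a\<close>.
  Hence the \<open>k\<close>-th diagonal of the Cauchy product of two such series convolves to
  \<open>(\<Sum>i\<le>k. l\<^sup>i s\<^sup>k\<^sup>-\<^sup>i) g\<^sub>c\<close> with \<open>c = \<alpha> k + a + b\<close>, and the geometric sum
  equals \<open>(l\<^sup>k\<^sup>+\<^sup>1 - s\<^sup>k\<^sup>+\<^sup>1) / (l - s)\<close>. Summation and integration may be exchanged because
  \<open>1 / \<Gamma>\<close> decays faster than any exponential. Both parts of the theorem are instances.
\<close>

text \<open>Euler's integral is cut down to the window from \<open>A\<close> to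
  \<open>A + 1\<close>, where \<open>x \<ge> 1\<close> makes \<open>t powr (x - 1)\<close> smallest
  at the left end and \<open>exp t\<close> is largest at the right end. As \<open>A\<close> is free,
  \<open>Gamma\<close> outgrows every exponential.\<close>

lemma Gamma_ge_powr:
  fixes A x :: real
  assumes "A > 0" "x \<ge> 1"
  shows "A powr (x - 1) / exp (A + 1) \<le> Gamma x"
proof -
  have int: "(\<lambda>t. t powr (x - 1) / exp t) integrable_on {A..A+1}"
    using assms by (intro integrable_continuous_real continuous_intros) auto
  have "A powr (x - 1) / exp (A + 1) = integral {A..A+1} (\<lambda>t. A powr (x - 1) / exp (A + 1))"
    by simp
  also have "\<dots> \<le> integral {A..A+1} (\<lambda>t. t powr (x - 1) / exp t)"
    using assms by (intro integral_le int integrable_const_ivl frac_le powr_mono2) auto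
  also have "\<dots> \<le> Gamma x"
    using assms by (intro has_integral_subset_le[OF _ integrable_integral[OF int] Gamma_integral_real]) auto
  finally show ?thesis .
qed

lemma summable_power_div_Gamma:
  fixes \<alpha> \<beta> M :: real
  assumes "\<alpha> > 0" "\<beta> > 0" "M \<ge> 0"
  shows "summable (\<lambda>n. M ^ n / Gamma (\<alpha> * real n + \<beta>))"
proof -
  \<comment> \<open>This \<open>A\<close> solves \<open>A powr \<alpha> = M + 1\<close>, so the
    lower bound for \<open>Gamma\<close> contains the factor \<open>(M + 1) ^ n\<close> and the
    series is dominated by a geometric one of ratio \<open>M / (M + 1) < 1\<close>.\<close>
  define A where "A = (M + 1) powr (1 / \<alpha>)"
  have A: "A > 0" "A powr \<alpha> = M + 1"
    using assms by (auto simp: A_def powr_powr)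
  define C where "C = exp (A + 1) / A powr (\<beta> - 1)"
  show ?thesis
  proof (rule summable_comparison_test')
    show "summable (\<lambda>n. C * (M / (M + 1)) ^ n)"
      using assms by (intro summable_mult summable_geometric) (auto simp: field_simps)
    \<comment> \<open>From this index on the argument of \<open>Gamma\<close> is at least 1, as
      \<open>Gamma_ge_powr\<close> demands.\<close>
    fix n assume n: "n \<ge> nat \<lceil>1 / \<alpha>\<rceil>"
    hence "1 / \<alpha> \<le> real n" by linarith
    hence ge1: "\<alpha> * real n + \<beta> \<ge> 1" using assms by (simp add: field_simps)
    have "(A powr \<alpha>) ^ n = A powr (\<alpha> * real n)"
      using A(1) by (simp add: powr_power mult.commute)
    hence "A powr (\<alpha> * real n + \<beta> - 1) = (M + 1) ^ n * A powr (\<beta> - 1)"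
      unfolding A(2) by (simp flip: powr_add add: algebra_simps)
    hence "(M + 1) ^ n / C \<le> Gamma (\<alpha> * real n + \<beta>)"
      using Gamma_ge_powr[OF A(1) ge1] by (simp add: C_def)
    moreover have "C > 0" using A by (simp add: C_def)
    ultimately have "M ^ n / Gamma (\<alpha> * real n + \<beta>) \<le> M ^ n / ((M + 1) ^ n / C)"
      using assms by (intro divide_left_mono mult_pos_pos) (auto intro!: Gamma_real_pos add_nonneg_pos)
    thus "norm (M ^ n / Gamma (\<alpha> * real n + \<beta>)) \<le> C * (M / (M + 1)) ^ n"
      using assms Gamma_real_pos[of "\<alpha> * real n + \<beta>"] ge1
      by (simp add: power_divide abs_of_pos mult.commute)
  qed
qed

text \<open>The kernel of the Riemann-Liouville fractional integral of order \<open>c\<close>. The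
  factor \<open>1 / Gamma c\<close> is what lets orders add under convolution with no constant left
  over.\<close>

definition power_kernel :: "real \<Rightarrow> real \<Rightarrow> real" where
  "power_kernel c t = t powr (c - 1) / Gamma c"

lemma power_kernel_nonneg: "c > 0 \<Longrightarrow> power_kernel c t \<ge> 0"
  by (simp add: power_kernel_def Gamma_real_pos less_imp_le)

text \<open>The prefactor \<open>t powr (a - 1)\<close> merges with the powers of
  \<open>t powr \<alpha>\<close>. Absolute convergence is recorded separately: the Cauchy product
  and the majorant for termwise integration both rest on it.\<close>

lemma power_kernel_series:
  assumes "\<alpha> > 0" "a > 0" "t > 0"
  shows summable_norm_power_kernel_series:
      "summable (\<lambda>n. norm (l ^ n * complex_of_real (power_kernel (\<alpha> * real n + a) t)))"
    and power_kernel_series_sums: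
      "(\<lambda>n. l ^ n * complex_of_real (power_kernel (\<alpha> * real n + a) t)) sums
        (of_real (t powr (a - 1)) * mittag_leffler \<alpha> a (l * of_real (t powr \<alpha>)))"
proof -
  let ?f = "\<lambda>n. (l * of_real (t powr \<alpha>)) ^ n / complex_of_real (Gamma (\<alpha> * real n + a))"
  have eq: "l ^ n * complex_of_real (power_kernel (\<alpha> * real n + a) t) = of_real (t powr (a - 1)) * ?f n" for n
  proof -
    have "t powr (\<alpha> * real n + a - 1) = (t powr \<alpha>) ^ n * t powr (a - 1)"
      using assms by (simp flip: powr_realpow add: powr_powr powr_add[symmetric] algebra_simps)
    thus ?thesis by (simp add: power_kernel_def power_mult_distrib)
  qed
  have "norm (?f n) = (norm l * t powr \<alpha>) ^ n / Gamma (\<alpha> * real n + a)" for n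
    using assms by (simp add: norm_divide norm_power norm_mult Gamma_real_pos add_nonneg_pos less_imp_le)
  hence sm: "summable (\<lambda>n. norm (?f n))"
    using summable_power_div_Gamma[of \<alpha> a "norm l * t powr \<alpha>"] assms by simp
  show "summable (\<lambda>n. norm (l ^ n * complex_of_real (power_kernel (\<alpha> * real n + a) t)))"
    unfolding eq norm_mult by (intro summable_mult) (use sm in \<open>simp add: norm_mult\<close>)
  show "(\<lambda>n. l ^ n * complex_of_real (power_kernel (\<alpha> * real n + a) t)) sums
        (of_real (t powr (a - 1)) * mittag_leffler \<alpha> a (l * of_real (t powr \<alpha>)))"
    unfolding eq mittag_leffler_def
    by (intro sums_mult summable_sums summable_norm_cancel[OF sm])
qed

text \<open>Rescaling \<open>x\<close> by \<open>t\<close> reduces the claim to the Beta integral on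
  the unit interval, and \<open>Beta b a\<close> cancels the two \<open>Gamma\<close> factors. The
  Bochner form delivers integrability together with the value.\<close>

lemma has_bochner_integral_power_kernel_convolution:
  assumes "a > 0" "b > 0" "t > 0"
  shows "has_bochner_integral lborel
    (\<lambda>x. indicator {0<..<t} x * (power_kernel a (t - x) * power_kernel b x)) (power_kernel (a + b) t)"
proof -
  let ?B = "\<lambda>x. x powr (b - 1) * (1 - x) powr (a - 1)"
  have int: "set_integrable lborel {0<..<1} ?B"
    by (rule set_integrable_subset[OF integrable_Beta]) (use assms in auto)
  \<comment> \<open>The Beta integral comes as a gauge integral; uniqueness of its value identifies
    it with the Lebesgue integral.\<close>
  have "(?B has_integral Beta b a) {0<..<1}"
    using has_integral_Beta_real[of b a] assms by (simp add: has_integral_Icc_iff_Ioo)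
  moreover have "(?B has_integral (LINT x:{0<..<1}|lborel. ?B x)) {0<..<1}"
    using set_borel_integral_eq_integral[OF int] by (simp add: has_integral_iff)
  ultimately have "(LINT x:{0<..<1}|lborel. ?B x) = Beta b a"
    by (rule has_integral_unique[symmetric])
  with int have "has_bochner_integral lborel (\<lambda>x. indicator {0<..<1} x * ?B x) (Beta b a)"
    by (simp add: has_bochner_integral_iff set_integrable_def set_lebesgue_integral_def)
  hence "has_bochner_integral lborel (\<lambda>x. indicator {0<..<1} (0 + 1/t * x) * ?B (0 + 1/t * x)) (t * Beta b a)"
    by (subst (asm) lborel_has_bochner_integral_real_affine_iff[of "1/t" _ _ 0]) (use assms in auto)
  \<comment> \<open>The power \<open>a + b - 2\<close> collects \<open>a - 1\<close> and
    \<open>b - 1\<close> from the two rescaled factors; the substitution supplies one more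
    \<open>t\<close>.\<close>
  hence "has_bochner_integral lborel
      (\<lambda>x. t powr (a + b - 2) / (Gamma a * Gamma b) * (indicator {0<..<1} (0 + 1/t * x) * ?B (0 + 1/t * x)))
      (t powr (a + b - 2) / (Gamma a * Gamma b) * (t * Beta b a))"
    by (rule has_bochner_integral_mult_right)
  also have "(\<lambda>x. t powr (a + b - 2) / (Gamma a * Gamma b) * (indicator {0<..<1} (0 + 1/t * x) * ?B (0 + 1/t * x)))
      = (\<lambda>x. indicator {0<..<t} x * (power_kernel a (t - x) * power_kernel b x))"
  proof
    fix x
    show "t powr (a + b - 2) / (Gamma a * Gamma b) * (indicator {0<..<1} (0 + 1/t * x) * ?B (0 + 1/t * x))
      = indicator {0<..<t} x * (power_kernel a (t - x) * power_kernel b x)"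
    proof (cases "x \<in> {0<..<t}")
      case True
      have "(1 - x / t) = (t - x) / t" using assms by (simp add: field_simps)
      moreover have "t powr (a + b - 2) = t powr (a - 1) * t powr (b - 1)"
        by (simp flip: powr_add add: algebra_simps)
      ultimately show ?thesis using True assms by (simp add: power_kernel_def powr_divide)
    next
      case False
      thus ?thesis using assms by (auto simp: indicator_def field_simps)
    qed
  qed
  also have "t powr (a + b - 2) / (Gamma a * Gamma b) * (t * Beta b a) = power_kernel (a + b) t"
  proof -
    have "t powr (a + b - 1) = t powr (a + b - 2) * t"
      using assms powr_mult_base[of t "a + b - 2"] by (simp add: algebra_simps)
    thus ?thesis using assms
      by (simp add: power_kernel_def Beta_def Gamma_real_pos less_imp_neq[symmetric] add.commute)
  qed
  finally show ?thesis .
qed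

text \<open>The common form of all three identities: \<open>R_fun\<close> has
  \<open>a = \<alpha> - v1\<close>, \<open>b = \<alpha> - v2\<close>, and \<open>P_fun\<close> has
  \<open>a = w1 + 1\<close>, \<open>b = w2 + 1\<close>.\<close>

lemma mittag_leffler_convolution:
  fixes \<alpha> a b t :: real and l s :: complex
  assumes \<alpha>: "\<alpha> > 0" and ab: "a > 0" "b > 0" and t: "t > 0" and ls: "l \<noteq> s"
  defines "F \<equiv> \<lambda>t. of_real (t powr (a - 1)) * mittag_leffler \<alpha> a (l * of_real (t powr \<alpha>))"
    and "G \<equiv> \<lambda>t. of_real (t powr (b - 1)) * mittag_leffler \<alpha> b (s * of_real (t powr \<alpha>))"
  shows "causal_conv_exists F G t \<and>
    causal_conv F G t = 1 / (l - s) *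
      (l * (of_real (t powr (a + b - 1)) * mittag_leffler \<alpha> (a + b) (l * of_real (t powr \<alpha>)))
       - s * (of_real (t powr (a + b - 1)) * mittag_leffler \<alpha> (a + b) (s * of_real (t powr \<alpha>))))"
proof -
  \<comment> \<open>One kernel from each series, multiplied. The indicator turns the convolution at
    \<open>t\<close> into an integral over the whole real line.\<close>
  define u where "u c x = indicator {0<..<t} x * (power_kernel (\<alpha> * real (fst c) + a) (t - x)
      * power_kernel (\<alpha> * real (snd c) + b) x)" for c :: "nat \<times> nat" and x :: real
  define f where "f k x = (\<Sum>i\<le>k. (l ^ i * s ^ (k - i)) * complex_of_real (u (i, k - i) x))" for k x
  define M where "M = max (norm l) (norm s)"
  define g where "g k = power_kernel (\<alpha> * real k + (a + b)) t" for k
  have pos: "\<alpha> * real n + a > 0" "\<alpha> * real n + b > 0" "\<alpha> * real n + (a + b) > 0" for n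
    using \<alpha> ab by (auto intro!: add_nonneg_pos)
  have u_nonneg: "u c x \<ge> 0" for c x
    unfolding u_def by (intro mult_nonneg_nonneg power_kernel_nonneg pos) auto
  have u_int: "has_bochner_integral lborel (u (i, k - i)) (g k)" if "i \<le> k" for i k
  proof -
    \<comment> \<open>Along an antidiagonal the orders have a constant sum, so all its terms share
      the integral \<open>g k\<close>.\<close>
    have "\<alpha> * real i + a + (\<alpha> * real (k - i) + b) = \<alpha> * real k + (a + b)"
      using that by (simp add: of_nat_diff algebra_simps)
    from has_bochner_integral_power_kernel_convolution[OF pos(1)[of i] pos(2)[of "k - i"] t, unfolded this]
    show ?thesis by (simp add: u_def[abs_def] g_def)
  qed
  have f_int: "has_bochner_integral lborel (f k) ((\<Sum>i\<le>k. l ^ i * s ^ (k - i)) * of_real (g k))" for k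
    unfolding f_def sum_distrib_right
    by (intro has_bochner_integral_sum has_bochner_integral_mult_right has_bochner_integral_of_real u_int) auto
  have geom: "(\<Sum>i\<le>k. l ^ i * s ^ (k - i)) = (l ^ Suc k - s ^ Suc k) / (l - s)" for k
    using ls diff_power_eq_sum[of l k s] by (simp add: lessThan_Suc_atMost)
  have fk_norm: "norm (f k x) \<le> (\<Sum>i\<le>k. M ^ k * u (i, k - i) x)" for k x
    unfolding f_def
  proof (rule sum_norm_le)
    fix i assume "i \<in> {..k}"
    hence i: "i \<le> k" by simp
    have "norm l ^ i * norm s ^ (k - i) \<le> M ^ i * M ^ (k - i)"
      unfolding M_def by (intro mult_mono power_mono) (auto simp: le_max_iff_disj)
    also have "\<dots> = M ^ k" using i by (simp flip: power_add)
    finally show "norm ((l ^ i * s ^ (k - i)) * complex_of_real (u (i, k - i) x)) \<le> M ^ k * u (i, k - i) x"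
      using u_nonneg[of "(i, k - i)" x] by (simp add: norm_mult norm_power mult_right_mono)
  qed
  \<comment> \<open>There are \<open>k + 1\<close> terms, each with coefficient of norm at most
    \<open>M ^ k\<close>. Bounding \<open>k + 1\<close> by \<open>2 ^ k\<close> makes the majorant a
    kernel series again, with parameter \<open>2 * M\<close>.\<close>
  have norm_int: "(\<integral>x. norm (f k x) \<partial>lborel) \<le> (2 * M) ^ k * g k" for k
  proof -
    have "(\<integral>x. norm (f k x) \<partial>lborel) \<le> (\<integral>x. (\<Sum>i\<le>k. M ^ k * u (i, k - i) x) \<partial>lborel)"
      using fk_norm f_int u_int
      by (intro integral_mono integrable_norm Bochner_Integration.integrable_sum integrable_mult_right)
         (auto simp: has_bochner_integral_iff)
    also have "\<dots> = real (Suc k) * (M ^ k * g k)"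
      using u_int by (subst Bochner_Integration.integral_sum) (auto simp: has_bochner_integral_iff)
    also have "\<dots> \<le> 2 ^ k * (M ^ k * g k)"
    proof (intro mult_right_mono)
      show "real (Suc k) \<le> 2 ^ k"
        using less_exp[of k] by (metis Suc_leI of_nat_le_iff of_nat_numeral of_nat_power)
      show "0 \<le> M ^ k * g k"
        unfolding g_def by (intro mult_nonneg_nonneg power_kernel_nonneg pos) (auto simp: M_def le_max_iff_disj)
    qed
    finally show ?thesis by (simp add: power_mult_distrib mult_ac)
  qed
  have sum_int: "summable (\<lambda>k. \<integral>x. norm (f k x) \<partial>lborel)"
  proof (rule summable_comparison_test')
    have "M \<ge> 0" by (auto simp: M_def le_max_iff_disj)
    have "summable (\<lambda>n. norm (complex_of_real (2 * M) ^ n *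
        complex_of_real (power_kernel (\<alpha> * real n + (a + b)) t)))"
      by (rule summable_norm_power_kernel_series) (use \<alpha> ab t in auto)
    moreover have "norm (complex_of_real (2 * M) ^ n *
        complex_of_real (power_kernel (\<alpha> * real n + (a + b)) t)) = (2 * M) ^ n * g n" for n
      using \<open>M \<ge> 0\<close> power_kernel_nonneg[OF pos(3)[of n], of t]
      by (simp add: norm_mult norm_power g_def power_mult_distrib)
    ultimately show "summable (\<lambda>n. (2 * M) ^ n * g n)" by simp
    show "norm (\<integral>x. norm (f k x) \<partial>lborel) \<le> (2 * M) ^ k * g k" for k
      using norm_int[of k] by simp
  qed
  \<comment> \<open>Inside the interval this is the Cauchy product of two absolutely convergent
    series; outside it everything vanishes.\<close>
  have product: "summable (\<lambda>k. norm (f k x)) \<and> (\<lambda>k. f k x) sums (indicator {0<..<t} x *\<^sub>R (F (t - x) * G x))" for x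
  proof (cases "x \<in> {0<..<t}")
    case True
    let ?p = "\<lambda>n. l ^ n * complex_of_real (power_kernel (\<alpha> * real n + a) (t - x))"
    let ?q = "\<lambda>n. s ^ n * complex_of_real (power_kernel (\<alpha> * real n + b) x)"
    have p: "summable (\<lambda>n. norm (?p n))" "?p sums F (t - x)"
      unfolding F_def using True \<alpha> ab by (auto intro!: power_kernel_series)
    have q: "summable (\<lambda>n. norm (?q n))" "?q sums G x"
      unfolding G_def using True \<alpha> ab by (auto intro!: power_kernel_series)
    have f_eq: "f k x = (\<Sum>i\<le>k. ?p i * ?q (k - i))" for k
      unfolding f_def u_def using True by (intro sum.cong) auto
    have "summable (\<lambda>k. \<Sum>i\<le>k. norm (?p i) * norm (?q (k - i)))"
      using p(1) q(1) by (intro summable_Cauchy_product) auto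
    hence "summable (\<lambda>k. norm (f k x))"
      by (rule summable_comparison_test'[where N = 0])
         (auto simp: f_eq norm_mult intro!: sum_norm_le)
    moreover have "(\<lambda>k. f k x) sums (F (t - x) * G x)"
      using Cauchy_product_sums[OF p(1) q(1)] p(2) q(2) by (simp add: f_eq sums_iff)
    ultimately show ?thesis using True by simp
  next
    case False
    hence "f k x = 0" for k by (simp add: f_def u_def)
    thus ?thesis using False by simp
  qed
  have suminf_f: "(\<Sum>k. f k x) = indicator {0<..<t} x *\<^sub>R (F (t - x) * G x)" for x
    using product[of x] by (simp add: sums_iff)
  have f_integrable: "integrable lborel (f k)" for k
    using f_int by (simp add: has_bochner_integral_iff)
  have ae: "AE x in lborel. summable (\<lambda>k. norm (f k x))"
    using product by simp
  \<comment> \<open>Pointwise absolute summability and summable \<open>L1\<close> norms permit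
    termwise integration; the same hypotheses make the sum integrable, which gives existence of the
    convolution.\<close>
  note sums = sums_integral[OF f_integrable ae sum_int]
  have ex: "causal_conv_exists F G t"
    using t integrable_suminf[OF f_integrable ae sum_int] by (simp add: suminf_f causal_conv_exists_def interval_lebesgue_integrable_def
        set_integrable_def zero_ereal_def)
  have conv: "(\<integral>x. (\<Sum>k. f k x) \<partial>lborel) = causal_conv F G t"
    using t by (simp add: suminf_f causal_conv_def interval_lebesgue_integral_def
        set_lebesgue_integral_def zero_ereal_def)
  have "(\<lambda>k. (l ^ Suc k - s ^ Suc k) / (l - s) * of_real (g k)) sums causal_conv F G t"
    using sums f_int by (simp add: conv geom has_bochner_integral_iff)
  moreover have "(\<lambda>k. 1 / (l - s) * (l * (l ^ k * of_real (g k)) - s * (s ^ k * of_real (g k)))) sums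
      (1 / (l - s) *
      (l * (of_real (t powr (a + b - 1)) * mittag_leffler \<alpha> (a + b) (l * of_real (t powr \<alpha>)))
       - s * (of_real (t powr (a + b - 1)) * mittag_leffler \<alpha> (a + b) (s * of_real (t powr \<alpha>)))))"
    unfolding g_def using \<alpha> ab t by (intro sums_mult sums_diff power_kernel_series_sums) auto
  moreover have "(l ^ Suc k - s ^ Suc k) / (l - s) * of_real (g k) =
      1 / (l - s) * (l * (l ^ k * of_real (g k)) - s * (s ^ k * of_real (g k)))" for k
    by (simp add: left_diff_distrib mult.assoc)
  ultimately show ?thesis using ex by (metis (no_types, lifting) ext sums_unique2)
qed

theorem theorem3p2:
  fixes \<alpha> t :: real and l s :: complex
  assumes "\<alpha> > 0" and "t > 0" and "l \<noteq> s"
  shows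
    "(\<forall>v1 v2 v :: real. v1 < \<alpha> \<and> v2 < \<alpha> \<and> v = v1 + v2 \<longrightarrow>
        causal_conv_exists (R_fun \<alpha> v1 l) (R_fun \<alpha> v2 s) t \<and>
        causal_conv (R_fun \<alpha> v1 l) (R_fun \<alpha> v2 s) t =
          1 / (l - s) * (l * R_fun \<alpha> (v - \<alpha>) l t - s * R_fun \<alpha> (v - \<alpha>) s t)) \<and>
     (\<forall>w1 w2 w :: real. w1 > -1 \<and> w2 > -1 \<and> w = w1 + w2 \<longrightarrow>
        (causal_conv_exists (P_fun \<alpha> w1 l) (P_fun \<alpha> w2 s) t \<and>
         causal_conv (P_fun \<alpha> w1 l) (P_fun \<alpha> w2 s) t =
           1 / (l - s) * (l * P_fun \<alpha> (w + 1) l t - s * P_fun \<alpha> (w + 1) s t)) \<and>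
        (let F = (\<lambda>t. of_real (t powr w1) * mittag_leffler \<alpha> (w1 + 1) (l * of_real (t powr \<alpha>)));
             G = (\<lambda>t. of_real (t powr w2) * mittag_leffler \<alpha> (w2 + 1) (s * of_real (t powr \<alpha>)))
         in causal_conv_exists F G t \<and>
            causal_conv F G t =
              1 / (l - s) *
                (l * of_real (t powr (w + 1)) * mittag_leffler \<alpha> (w + 2) (l * of_real (t powr \<alpha>))
                 - s * of_real (t powr (w + 1)) * mittag_leffler \<alpha> (w + 2) (s * of_real (t powr \<alpha>)))))"
proof -
  have R: "causal_conv_exists (R_fun \<alpha> v1 l) (R_fun \<alpha> v2 s) t \<and>
        causal_conv (R_fun \<alpha> v1 l) (R_fun \<alpha> v2 s) t =
          1 / (l - s) * (l * R_fun \<alpha> (v1 + v2 - \<alpha>) l t - s * R_fun \<alpha> (v1 + v2 - \<alpha>) s t)"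
    if "v1 < \<alpha>" "v2 < \<alpha>" for v1 v2
  proof -
    \<comment> \<open>This index identity is the origin of the shift to \<open>v - \<alpha>\<close>
      on the right-hand side.\<close>
    have "\<alpha> - v1 + (\<alpha> - v2) = \<alpha> - (v1 + v2 - \<alpha>)" by simp
    thus ?thesis
      using mittag_leffler_convolution[of \<alpha> "\<alpha> - v1" "\<alpha> - v2" t l s] assms that
      by (simp add: R_fun_def[abs_def])
  qed
  have P: "causal_conv_exists (P_fun \<alpha> w1 l) (P_fun \<alpha> w2 s) t \<and>
         causal_conv (P_fun \<alpha> w1 l) (P_fun \<alpha> w2 s) t =
           1 / (l - s) * (l * P_fun \<alpha> (w1 + w2 + 1) l t - s * P_fun \<alpha> (w1 + w2 + 1) s t)"
    if "w1 > -1" "w2 > -1" for w1 w2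
  proof -
    have eq: "w1 + 1 + (w2 + 1) = w1 + w2 + 1 + 1" "w1 + w2 + 1 + 1 - 1 = w1 + w2 + 1" by simp_all
    from mittag_leffler_convolution[of \<alpha> "w1 + 1" "w2 + 1" t l s, unfolded eq]
    show ?thesis
      using assms that unfolding P_fun_def[abs_def] by simp
  qed
  \<comment> \<open>The third identity is the second with \<open>P_fun\<close> unfolded:
    \<open>PE\<close> treats its right-hand side, \<open>fold_P\<close> its two convolution
    factors.\<close>
  have PE: "1 / (l - s) * (l * P_fun \<alpha> (w1 + w2 + 1) l t - s * P_fun \<alpha> (w1 + w2 + 1) s t) =
      1 / (l - s) * (l * of_real (t powr (w1 + w2 + 1)) * mittag_leffler \<alpha> (w1 + w2 + 2) (l * of_real (t powr \<alpha>))
        - s * of_real (t powr (w1 + w2 + 1)) * mittag_leffler \<alpha> (w1 + w2 + 2) (s * of_real (t powr \<alpha>)))" for w1 w2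
  proof -
    have "w1 + w2 + 1 + 1 = w1 + w2 + 2" by simp
    thus ?thesis unfolding P_fun_def by (simp only: mult.assoc)
  qed
  have fold_P: "(\<lambda>t. of_real (t powr w) * mittag_leffler \<alpha> (w + 1) (c * of_real (t powr \<alpha>))) = P_fun \<alpha> w c" for w c
    by (simp add: P_fun_def[abs_def])
  show ?thesis
    unfolding Let_def fold_P using R P P[unfolded PE] by blast
qed

end
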